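(* Let $\varphi_3$ be the monoid homomorphism $\mathcal{A}_3^{\star}\to UT_{15}(\mathbb{S})$ determined by $\varepsilon\mapsto \mathrm{E}_{15}$, \begin{align*} 1&\mapsto \mathsf{diag}\{s,\mathrm{P},\mathrm{P},\mathrm{E}_2,\mathbf{1},\mathrm{J},\mathrm{E}_2,\mathrm{J},\mathbf{1}\},\\ 2&\mapsto \mathsf{diag}\{\mathbf{1},\mathrm{K},\mathrm{K},\mathrm{P},s,\mathrm{Q},\mathrm{J},\mathrm{J},\mathbf{1}\},\\ 3&\mapsto \mathsf{diag}\{\mathbf{1},\mathrm{K},\mathrm{E}_2,\mathrm{K},\mathbf{1},\mathrm{E}_2,\mathrm{Q},\mathrm{Q},s\}. \end{align*} Then $\varphi_3$ induces a map $\varphi_3:(\mathsf{baxt}_3,{}^{\sharp})\to (UT_{15}(\mathbb{S}),{}^{D})$ which is a faithful representation of the involution monoid $(\mathsf{baxt}_3,{}^{\sharp})$, i.e. an injective homomorphism of involution monoids.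
   Context: Baxter monoid: for $n\ge 1$ let $\mathcal{A}_n=\{1<2<\cdots<n\}$ and let $\mathcal{A}_n^{\star}$ be the free monoid on $\mathcal{A}_n$ with empty word $\varepsilon$. Then $\mathsf{baxt}_n=\mathcal{A}_n^{\star}/\!\equiv$, where $\equiv$ is the congruence generated by all pairs $(c\mathbf{u}ad\mathbf{v}b,\ c\mathbf{u}da\mathbf{v}b)$ with $a\le b<c\le d$ and $(b\mathbf{u}da\mathbf{v}c,\ b\mathbf{u}ad\mathbf{v}c)$ with $a<b\le c<d$, where $a,b,c,d\in\mathcal{A}_n$, $\mathbf{u},\mathbf{v}\in\mathcal{A}_n^{\star}$. Schützenberger's involution $^{\sharp}$ on $\mathsf{baxt}_n$ is induced by $i^{\sharp}=n+1-i$ and $(w_1\cdots w_k)^{\sharp}=w_k^{\sharp}\cdots w_1^{\sharp}$ (this is compatible with $\equiv$). Semiring: $\mathbb{S}$ is a commutative idempotent semiring ($(S,+)$ and $(S,\cdot)$ are commutative monoids with identities $\mathbf{0}$ and $\mathbf{1}$ respectively, multiplication distributes over addition, $\mathbf{0}\cdot a=\mathbf{0}$, and $a+a=a$ for all $a$) containing an element $s$ of infinite multiplicative order, meaning that for non-negative integers $i,j$, $s^i=s^j$ iff $i=j$. Matrices: $UT_m(\mathbb{S})$ is the monoid of upper triangular $m\times m$ matrices over $\mathbb{S}$ under matrix multiplication; $^D$ is the skew transposition $(A^D)_{ij}=A_{(m+1-j)(m+1-i)}$, an involution on it. $\mathrm{E}_m$ is the $m\times m$ identity matrix, $\mathsf{diag}\{\cdots\}$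 denotes a block diagonal matrix, and \[ \mathrm{P}=\begin{pmatrix} s&\mathbf{0}\\ \mathbf{0}&\mathbf{1}\end{pmatrix},\quad \mathrm{Q}=\begin{pmatrix} \mathbf{1}&\mathbf{0}\\ \mathbf{0}&s\end{pmatrix},\quad \mathrm{J}=\begin{pmatrix} \mathbf{1}&\mathbf{1}\\ \mathbf{0}&\mathbf{0}\end{pmatrix},\quad \mathrm{K}=\begin{pmatrix} \mathbf{0}&\mathbf{1}\\ \mathbf{0}&\mathbf{1}\end{pmatrix}. \] *)

theory Defs
  imports "HOL-Algebra.Group" "Jordan_Normal_Form.Matrix"
begin

locale involution_monoid = monoid M for M (structure) +
  fixes star :: "'a \<Rightarrow> 'a"
  assumes star_closed: "x \<in> carrier M \<Longrightarrow> star x \<in> carrier M"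
    and star_star: "x \<in> carrier M \<Longrightarrow> star (star x) = x"
    and star_mult: "\<lbrakk>x \<in> carrier M; y \<in> carrier M\<rbrakk> \<Longrightarrow> star (x \<otimes> y) = star y \<otimes> star x"

definition involution_monoid_hom ::
    "('a, 'c) monoid_scheme \<Rightarrow> ('a \<Rightarrow> 'a) \<Rightarrow> ('b, 'd) monoid_scheme \<Rightarrow> ('b \<Rightarrow> 'b) \<Rightarrow> ('a \<Rightarrow> 'b) set" where
  "involution_monoid_hom M starM N starN =
     {h \<in> hom M N. h \<one>\<^bsub>M\<^esub> = \<one>\<^bsub>N\<^esub> \<and> (\<forall>x\<in>carrier M. h (starM x) = starN (h x))}"

inductive_set generated_congruence :: "'a set \<Rightarrow> ('a list \<times> 'a list) set \<Rightarrow> ('a list \<times> 'a list) set"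
  for A :: "'a set" and R :: "('a list \<times> 'a list) set" where
  gen: "\<lbrakk>(u, v) \<in> R; u \<in> lists A; v \<in> lists A\<rbrakk> \<Longrightarrow> (u, v) \<in> generated_congruence A R"
| refl: "w \<in> lists A \<Longrightarrow> (w, w) \<in> generated_congruence A R"
| sym: "(u, v) \<in> generated_congruence A R \<Longrightarrow> (v, u) \<in> generated_congruence A R"
| trans: "\<lbrakk>(u, v) \<in> generated_congruence A R; (v, w) \<in> generated_congruence A R\<rbrakk>
    \<Longrightarrow> (u, w) \<in> generated_congruence A R"
| append: "\<lbrakk>(u, v) \<in> generated_congruence A R; (u', v') \<in> generated_congruence A R\<rbrakk>
    \<Longrightarrow> (u @ u', v @ v') \<in> generated_congruence A R"

abbreviation words :: "nat \<Rightarrow> nat list set" where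
  "words n \<equiv> lists {1..n}"

definition baxt_pairs :: "nat \<Rightarrow> (nat list \<times> nat list) set" where
  "baxt_pairs n =
     {([c] @ u @ [a, d] @ v @ [b], [c] @ u @ [d, a] @ v @ [b]) | a b c d u v.
        {a, b, c, d} \<subseteq> {1..n} \<and> u \<in> words n \<and> v \<in> words n \<and> a \<le> b \<and> b < c \<and> c \<le> d}
   \<union> {([b] @ u @ [d, a] @ v @ [c], [b] @ u @ [a, d] @ v @ [c]) | a b c d u v.
        {a, b, c, d} \<subseteq> {1..n} \<and> u \<in> words n \<and> v \<in> words n \<and> a < b \<and> b \<le> c \<and> c < d}"

definition baxt_rel :: "nat \<Rightarrow> (nat list \<times> nat list) set" where
  "baxt_rel n = generated_congruence {1..n} (baxt_pairs n)"

definition baxt_class :: "nat \<Rightarrow> nat list \<Rightarrow> nat list set" where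
  "baxt_class n w = baxt_rel n `` {w}"

definition baxt :: "nat \<Rightarrow> nat list set monoid" where
  "baxt n = \<lparr>carrier = words n // baxt_rel n,
             mult = (\<lambda>X Y. \<Union>x\<in>X. \<Union>y\<in>Y. baxt_class n (x @ y)),
             one = baxt_class n []\<rparr>"

definition sharp_word :: "nat \<Rightarrow> nat list \<Rightarrow> nat list" where
  "sharp_word n w = rev (map (\<lambda>i. n + 1 - i) w)"

definition sharp :: "nat \<Rightarrow> nat list set \<Rightarrow> nat list set" where
  "sharp n X = (\<Union>x\<in>X. baxt_class n (sharp_word n x))"

definition UT :: "nat \<Rightarrow> 's::comm_semiring_1 mat monoid" where
  "UT m = \<lparr>carrier = {A \<in> carrier_mat m m. upper_triangular A}, mult = (*), one = 1\<^sub>m m\<rparr>"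

text \<open>Matrix indices start at 0 in the library, so the index \<open>m + 1 - j\<close> becomes \<open>m - 1 - j\<close>.\<close>

definition skew_transpose :: "nat \<Rightarrow> 's mat \<Rightarrow> 's mat" where
  "skew_transpose m A = mat m m (\<lambda>(i, j). A $$ (m - 1 - j, m - 1 - i))"

definition word_hom :: "('b, 'c) monoid_scheme \<Rightarrow> ('a \<Rightarrow> 'b) \<Rightarrow> 'a list \<Rightarrow> 'b" where
  "word_hom M g w = foldr (\<lambda>x y. g x \<otimes>\<^bsub>M\<^esub> y) w \<one>\<^bsub>M\<^esub>"

definition matP :: "'s::comm_semiring_1 \<Rightarrow> 's mat" where "matP s = mat_of_rows_list 2 [[s, 0], [0, 1]]"
definition matQ :: "'s::comm_semiring_1 \<Rightarrow> 's mat" where "matQ s = mat_of_rows_list 2 [[1, 0], [0, s]]"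
definition matJ :: "'s::comm_semiring_1 mat" where "matJ = mat_of_rows_list 2 [[1, 1], [0, 0]]"
definition matK :: "'s::comm_semiring_1 mat" where "matK = mat_of_rows_list 2 [[0, 1], [0, 1]]"

abbreviation scalar_block :: "'s \<Rightarrow> 's mat" where
  "scalar_block x \<equiv> mat_of_rows_list 1 [[x]]"

text \<open>Only the values at the letters 1, 2, 3 matter; the last branch is the image of 3.\<close>

definition phi3_letter :: "'s::comm_semiring_1 \<Rightarrow> nat \<Rightarrow> 's mat" where
  "phi3_letter s i = diag_block_mat
     (if i = 1 then
        [scalar_block s, matP s, matP s, 1\<^sub>m 2, scalar_block 1, matJ, 1\<^sub>m 2, matJ, scalar_block 1]
      else if i = 2 then
        [scalar_block 1, matK, matK, matP s, scalar_block s, matQ s, matJ, matJ, scalar_block 1]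
      else
        [scalar_block 1, matK, 1\<^sub>m 2, matK, scalar_block 1, 1\<^sub>m 2, matQ s, matQ s, scalar_block s])"

definition phi3 :: "'s::comm_semiring_1 \<Rightarrow> nat list \<Rightarrow> 's mat" where
  "phi3 s = word_hom (UT 15) (phi3_letter s)"

end

theory Submission
  imports Defs
begin

text \<open>
  In the Baxter monoid two adjacent letters \<open>a < d\<close> may be swapped if and only if some letter to
  their left lies in \<open>{a<..d}\<close> and some letter to their right lies in \<open>{a..<d}\<close>. Such a swap does
  not change the content of a word, nor the number of letters \<open>a\<close> before the first letter in
  \<open>{a<..d}\<close>, nor the number of letters \<open>d\<close> after the last letter in \<open>{a..<d}\<close>. Conversely, these
  numbers determine the class of a word: if two words agree on them, the first letter at which they
  differ can be moved into place by swaps, since an obstruction to a swap would show up in one of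
  the numbers. For three letters these are nine numbers, and the nine diagonal blocks of
  \<^const>\<open>phi3\<close> record one of them each, as an exponent of \<open>s\<close>.
\<close>

subsection \<open>Invariants of the Baxter congruence\<close>

text \<open>If \<open>Y\<close> never occurs, \<open>takeWhile\<close> keeps the whole word and the
  value is the full count of \<open>x\<close>.\<close>

definition before :: "'a \<Rightarrow> 'a set \<Rightarrow> 'a list \<Rightarrow> nat" where
  "before x Y w = count_list (takeWhile (\<lambda>z. z \<notin> Y) w) x"

definition after :: "'a \<Rightarrow> 'a set \<Rightarrow> 'a list \<Rightarrow> nat" where
  "after x Y w = before x Y (rev w)"

lemma before_Nil [simp]: "before x Y [] = 0"
  by (simp add: before_def)

lemma before_Cons:
  "before x Y (z # w) = (if z \<in> Y then 0 else if z = x then Suc (before x Y w) else before x Y w)"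
  by (simp add: before_def)

lemma before_append:
  "before x Y (u @ v) = (if set u \<inter> Y = {} then count_list u x + before x Y v else before x Y u)"
  by (induction u) (auto simp: before_Cons)

lemma after_append:
  "after x Y (u @ v) = (if set v \<inter> Y = {} then count_list v x + after x Y u else after x Y v)"
  by (simp add: after_def before_append)

lemma after_Nil [simp]: "after x Y [] = 0"
  by (simp add: after_def)

lemma after_Cons:
  "after x Y (z # w) = (if set w \<inter> Y = {} then count_list w x + of_bool (z \<notin> Y \<and> z = x) else after x Y w)"
  using after_append[of x Y "[z]" w] by (simp add: after_def before_Cons)

lemma before_le: "before x Y w \<le> count_list w x"
  by (induction w) (auto simp: before_Cons)

lemma after_le: "after x Y w \<le> count_list w x"
  using before_le[of x Y "rev w"] by (simp add: after_def)

lemma before_disjoint: "set w \<inter> Y = {} \<Longrightarrow> before x Y w = count_list w x"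
  by (induction w) (auto simp: before_Cons)

lemma after_disjoint: "set w \<inter> Y = {} \<Longrightarrow> after x Y w = count_list w x"
  by (simp add: after_def before_disjoint)

lemma before_cong: "set w \<inter> Y = set w \<inter> Y' \<Longrightarrow> before x Y w = before x Y' w"
  unfolding before_def by (rule arg_cong[where f = "\<lambda>w. count_list w x"], rule takeWhile_cong) auto

lemma after_cong: "set w \<inter> Y = set w \<inter> Y' \<Longrightarrow> after x Y w = after x Y' w"
  unfolding after_def by (rule before_cong) simp

text \<open>Prepending a letter raises the value by at most one. In this form the recursion matches
  left multiplication by a letter block, see \<open>JQ_block_mult\<close>.\<close>

lemma after_Cons_Suc:
  "after x Y (z # w)
    = (if set w \<inter> Y = {} \<and> z \<notin> Y \<and> z = x then Suc (after x Y w) else after x Y w)"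
  by (auto simp: after_Cons after_disjoint)

text \<open>The pairs range over all naturals instead of an alphabet, so the relation is independent
  of \<open>n\<close>; \<open>same_invariants_words\<close> recovers the finite test.\<close>

definition same_invariants :: "nat list \<Rightarrow> nat list \<Rightarrow> bool" where
  "same_invariants u v \<longleftrightarrow> (\<forall>x. count_list u x = count_list v x)
     \<and> (\<forall>a d. a < d \<longrightarrow> before a {a<..d} u = before a {a<..d} v)
     \<and> (\<forall>a d. a < d \<longrightarrow> after d {a..<d} u = after d {a..<d} v)"

lemma same_invariantsD:
  assumes "same_invariants u v"
  shows "count_list u x = count_list v x" "set u = set v"
    "a < d \<Longrightarrow> before a {a<..d} u = before a {a<..d} v"
    "a < d \<Longrightarrow> after d {a..<d} u = after d {a..<d} v"
proof -
  show "set u = set v"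
    using assms unfolding same_invariants_def
    by (metis count_list_0_iff subsetI subset_antisym)
qed (use assms in \<open>auto simp: same_invariants_def\<close>)

text \<open>Clipping an interval to the alphabet does not change which letters of the words it
  contains. What remains are intervals without any letter of the alphabet, where the invariant is a
  full count, and counted letters outside the alphabet, where it is zero.\<close>

lemma same_invariants_words:
  assumes w: "u \<in> words n" "v \<in> words n"
    and cnt: "\<And>x. x \<in> {1..n} \<Longrightarrow> count_list u x = count_list v x"
    and bef: "\<And>a d. 1 \<le> a \<Longrightarrow> a < d \<Longrightarrow> d \<le> n \<Longrightarrow> before a {a<..d} u = before a {a<..d} v"
    and aft: "\<And>a d. 1 \<le> a \<Longrightarrow> a < d \<Longrightarrow> d \<le> n \<Longrightarrow> after d {a..<d} u = after d {a..<d} v"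
  shows "same_invariants u v"
  unfolding same_invariants_def
proof (intro conjI allI impI)
  have sub: "set u \<subseteq> {1..n}" "set v \<subseteq> {1..n}" using w by auto
  have out: "count_list u x = 0 \<and> count_list v x = 0" if "x \<notin> {1..n}" for x
    using that sub by (auto simp: count_list_0_iff)
  then show count: "count_list u x = count_list v x" for x
    using cnt by metis
  fix a d :: nat assume "a < d"
  show "before a {a<..d} u = before a {a<..d} v"
  proof (cases "a \<in> {1..<n}")
    case True
    have "before a {a<..d} x = before a {a<..min d n} x" if "set x \<subseteq> {1..n}" for x
      by (rule before_cong) (use that in auto)
    then show ?thesis using bef[of a "min d n"] True \<open>a < d\<close> sub by simp
  next
    case False
    show ?thesis
    proof (cases "a = n")
      case True
      then show ?thesis using sub count by (subst (1 2) before_disjoint) auto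
    next
      case False
      then have "a \<notin> {1..n}" using \<open>a \<notin> {1..<n}\<close> by auto
      from out[OF this] show ?thesis
        using before_le[of a "{a<..d}" u] before_le[of a "{a<..d}" v] by simp
    qed
  qed
  show "after d {a..<d} u = after d {a..<d} v"
  proof (cases "d \<in> {1<..n}")
    case True
    have "after d {a..<d} x = after d {max 1 a..<d} x" if "set x \<subseteq> {1..n}" for x
      by (rule after_cong) (use that in auto)
    then show ?thesis using aft[of "max 1 a" d] True \<open>a < d\<close> sub by simp
  next
    case False
    show ?thesis
    proof (cases "d = 1")
      case True
      then show ?thesis using sub count by (subst (1 2) after_disjoint) auto
    next
      case False
      then have "d \<notin> {1..n}" using \<open>d \<notin> {1<..n}\<close> \<open>a < d\<close> by auto
      from out[OF this] show ?thesis
        using after_le[of d "{a..<d}" u] after_le[of d "{a..<d}" v] by simp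
    qed
  qed
qed

text \<open>The values of a concatenation depend only on the values, counts and letter sets of its
  factors, and equal counts force equal sets.\<close>

lemma same_invariants_append:
  assumes "same_invariants u v" "same_invariants u' v'"
  shows "same_invariants (u @ u') (v @ v')"
  using same_invariantsD[OF assms(1)] same_invariantsD[OF assms(2)]
  by (simp add: same_invariants_def before_append after_append)

text \<open>The order of \<open>y\<close> and \<open>z\<close> matters only if one of them is
  counted and the other stops the count; in that case the count has already stopped inside
  \<open>p\<close>.\<close>

lemma before_swap:
  assumes "x = y \<Longrightarrow> z \<in> Y \<Longrightarrow> set p \<inter> Y \<noteq> {}" "x = z \<Longrightarrow> y \<in> Y \<Longrightarrow> set p \<inter> Y \<noteq> {}"
  shows "before x Y (p @ [y, z] @ q) = before x Y (p @ [z, y] @ q)"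
  using assms by (auto simp: before_append before_Cons)

text \<open>For \<open>before\<close>, only pairs \<open>(a, y)\<close> with
  \<open>d \<le> y\<close> could notice the swap, and then \<open>l\<close> lies in
  \<open>{a<..y}\<close> and has stopped the count earlier. The letter \<open>r\<close> plays the
  same role for \<open>after\<close>.\<close>

lemma same_invariants_swap:
  assumes "a < d" "l \<in> set p" "l \<in> {a<..d}" "r \<in> set q" "r \<in> {a..<d}"
  shows "same_invariants (p @ [a, d] @ q) (p @ [d, a] @ q)"
  unfolding same_invariants_def
proof (intro conjI allI impI)
  fix x y :: nat assume "x < y"
  show "before x {x<..y} (p @ [a, d] @ q) = before x {x<..y} (p @ [d, a] @ q)"
    by (rule before_swap) (use assms in auto)
  \<comment> \<open>Reversal turns \<open>after\<close> into \<open>before\<close>, with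
    \<open>rev q\<close> as the part that is read first.\<close>
  have "before y {x..<y} (rev q @ [d, a] @ rev p) = before y {x..<y} (rev q @ [a, d] @ rev p)"
    by (rule before_swap) (use assms in auto)
  then show "after y {x..<y} (p @ [a, d] @ q) = after y {x..<y} (p @ [d, a] @ q)"
    by (simp add: after_def)
qed simp

text \<open>In both families of generators \<open>a < d\<close>, the outer left letter lies in
  \<open>{a<..d}\<close> and the outer right one in \<open>{a..<d}\<close>, so each is an instance
  of \<open>same_invariants_swap\<close>, up to symmetry.\<close>

lemma baxt_rel_sound:
  assumes "(u, v) \<in> baxt_rel n"
  shows "u \<in> words n \<and> v \<in> words n \<and> same_invariants u v"
  using assms unfolding baxt_rel_def
proof (induction rule: generated_congruence.induct)
  case (gen u v)
  have "same_invariants u v"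
    using gen.hyps(1) unfolding baxt_pairs_def
  proof (elim UnE CollectE exE conjE)
    fix a b c d p q
    assume "(u, v) = ([c] @ p @ [a, d] @ q @ [b], [c] @ p @ [d, a] @ q @ [b])"
      and "a \<le> b" "b < c" "c \<le> d"
    then show ?thesis using same_invariants_swap[of a d c "[c] @ p" b "q @ [b]"] by simp
  next
    fix a b c d p q
    assume "(u, v) = ([b] @ p @ [d, a] @ q @ [c], [b] @ p @ [a, d] @ q @ [c])"
      and "a < b" "b \<le> c" "c < d"
    then have "same_invariants v u" using same_invariants_swap[of a d b "[b] @ p" c "q @ [c]"] by simp
    then show ?thesis by (simp add: same_invariants_def)
  qed
  with gen show ?case by blast
next
  case (append u v u' v')
  then show ?case by (simp add: same_invariants_append)
qed (auto simp: same_invariants_def)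

section \<open>Completeness of the invariants by moving letters\<close>

lemma baxt_rel_refl: "w \<in> words n \<Longrightarrow> (w, w) \<in> baxt_rel n"
  unfolding baxt_rel_def by (rule generated_congruence.refl)

lemma baxt_rel_sym: "(u, v) \<in> baxt_rel n \<Longrightarrow> (v, u) \<in> baxt_rel n"
  unfolding baxt_rel_def by (rule generated_congruence.sym)

lemma baxt_rel_trans: "(u, v) \<in> baxt_rel n \<Longrightarrow> (v, w) \<in> baxt_rel n \<Longrightarrow> (u, w) \<in> baxt_rel n"
  unfolding baxt_rel_def by (rule generated_congruence.trans)

lemma baxt_rel_append:
  "(u, v) \<in> baxt_rel n \<Longrightarrow> (u', v') \<in> baxt_rel n \<Longrightarrow> (u @ u', v @ v') \<in> baxt_rel n"
  unfolding baxt_rel_def by (rule generated_congruence.append)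

lemma baxt_rel_swap:
  assumes "a < d" "l \<in> set p" "l \<in> {a<..d}" "r \<in> set q" "r \<in> {a..<d}" "p @ [a, d] @ q \<in> words n"
  shows "(p @ [a, d] @ q, p @ [d, a] @ q) \<in> baxt_rel n"
proof -
  obtain p1 p2 where p: "p = p1 @ l # p2" using assms(2) by (meson split_list)
  obtain q1 q2 where q: "q = q1 @ r # q2" using assms(4) by (meson split_list)
  have core: "([l] @ p2 @ [a, d] @ q1 @ [r], [l] @ p2 @ [d, a] @ q1 @ [r]) \<in> baxt_rel n"
  \<comment> \<open>The order of the outer letters decides the family: \<open>r < l\<close> is the
    first with \<open>b = r\<close> and \<open>c = l\<close>, while \<open>l \<le> r\<close> is the
    second with \<open>b = l\<close> and \<open>c = r\<close>.\<close>
  proof (cases "r < l")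
    case True
    with assms p q have "([l] @ p2 @ [a, d] @ q1 @ [r], [l] @ p2 @ [d, a] @ q1 @ [r]) \<in> baxt_pairs n"
      unfolding baxt_pairs_def by (intro UnI1) fastforce
    then show ?thesis unfolding baxt_rel_def
      by (rule generated_congruence.gen) (use assms p q in auto)
  next
    case False
    with assms p q have "([l] @ p2 @ [d, a] @ q1 @ [r], [l] @ p2 @ [a, d] @ q1 @ [r]) \<in> baxt_pairs n"
      unfolding baxt_pairs_def by (intro UnI2) fastforce
    then have "([l] @ p2 @ [d, a] @ q1 @ [r], [l] @ p2 @ [a, d] @ q1 @ [r]) \<in> baxt_rel n"
      unfolding baxt_rel_def
      by (rule generated_congruence.gen) (use assms p q in auto)
    then show ?thesis by (rule baxt_rel_sym)
  qed
  have "(p1, p1) \<in> baxt_rel n" "(q2, q2) \<in> baxt_rel n"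
    using assms p q by (auto simp del: One_nat_def intro: baxt_rel_refl)
  from baxt_rel_append[OF this(1) baxt_rel_append[OF core this(2)]]
  show ?thesis by (simp add: p q)
qed

text \<open>If two words with the same invariants first differ in that the letter \<open>x\<close> has to be moved to
  the left, over \<open>z\<close> among others, then the letters around \<open>z x\<close> allow these two to be swapped.\<close>

lemma swap_allowed:
  assumes inv: "same_invariants (p @ x # r) (p @ t @ z # x # q)"
    and t: "x \<notin> set t" and ne: "z \<noteq> x"
  shows "(\<exists>l\<in>set (p @ t). l \<in> {min x z<..max x z}) \<and> (\<exists>l\<in>set q. l \<in> {min x z..<max x z})"
proof -
  note D = same_invariantsD[OF inv]
  have rx: "count_list r x = count_list q x" using D(1)[of x] t ne by simp
  have rz: "count_list r y = count_list t y + of_bool (y = z) + count_list q y" if "y \<noteq> x" for y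
    using D(1)[of y] that by (auto split: if_splits)
  show ?thesis
  proof (cases "x < z")
    case True
    \<comment> \<open>Otherwise \<open>before x {x<..z}\<close> is stopped by the displayed
      \<open>z\<close> in the second word, after the \<open>x\<close> of \<open>p\<close> only, but
      the first word also counts the displayed \<open>x\<close>.\<close>
    have "\<exists>l\<in>set (p @ t). l \<in> {x<..z}"
    proof (rule ccontr)
      assume "\<not> ?thesis"
      then have "set p \<inter> {x<..z} = {}" "set t \<inter> {x<..z} = {}" by auto
      then show False using D(3)[OF True] True t by (simp add: before_append before_Cons)
    qed
    moreover have "\<exists>l\<in>set q. l \<in> {x..<z}"
    proof (rule ccontr)
      assume "\<not> ?thesis"
      then have q: "set q \<inter> {x..<z} = {}" by auto
      then have "x \<notin> set q" using True by auto
      then have xr: "x \<notin> set r" using rx by (metis count_list_0_iff)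
      have aq: "after z {x..<z} (p @ t @ z # x # q) = count_list q z"
        using True q by (simp add: after_append after_Cons)
      show False
      proof (cases "set r \<inter> {x..<z} = {}")
        \<comment> \<open>Here every \<open>z\<close> of \<open>r\<close> is counted, and
          \<open>r\<close> contains at least one \<open>z\<close> more than
          \<open>q\<close>.\<close>
        case nor: True
        then have "after z {x..<z} (p @ x # r) = count_list r z"
          using True by (simp add: after_append after_Cons)
        then show False using aq D(4)[OF True] rz[of z] ne by simp
      next
        case False
        then have "\<exists>e\<in>set r. e \<in> {x..<z}" by blast
        \<comment> \<open>The last letter \<open>e\<close> of \<open>{x..<z}\<close> in the first word is not \<open>x\<close>, so the invariant
          for the pair \<open>(e, z)\<close> is available.\<close>
        then obtain r1 e r2 where r: "r = r1 @ e # r2" and e: "e \<in> {x..<z}"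
          and r2: "\<forall>y\<in>set r2. y \<notin> {x..<z}"
          using split_list_last_prop[of r "\<lambda>e. e \<in> {x..<z}"] by blast
        have r2': "set r2 \<inter> {x..<z} = {}" using r2 by blast
        have ex: "x < e" "e < z" using e xr r by (auto simp: order.order_iff_strict)
        have eq: "e \<notin> set q" using q e by blast
        have "count_list r e \<noteq> 0" using r by (simp add: count_list_0_iff)
        then have et: "e \<in> set t" using rz[of e] ex eq by (auto simp: count_list_0_iff)
        have 1: "after z {x..<z} (p @ x # r) = count_list r2 z"
          using r2' e by (simp add: r after_append after_Cons)
        have r2e: "set r2 \<inter> {e..<z} = {}" using r2' ex by auto
        have 2: "after z {e..<z} (p @ x # r) = count_list r2 z"
          using r2e ex by (simp add: r after_append after_Cons)
        have qe: "set q \<inter> {e..<z} = {}" using q ex by auto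
        \<comment> \<open>The letter \<open>x\<close> is below \<open>e\<close> and no longer stops
          the count, while \<open>e\<close> occurs only further left, for instance in
          \<open>t\<close>; so the \<open>z\<close> in front of \<open>x\<close> is counted as
          well.\<close>
        have 3: "after z {e..<z} (p @ t @ z # x # q) \<ge> count_list q z + 1"
          using qe et ex by (auto simp add: after_append after_Cons)
        show False using 1 2 3 aq D(4)[OF True] D(4)[OF ex(2)] by simp
      qed
    qed
    ultimately show ?thesis using True by simp
  next
    case False
    then have zx: "z < x" using ne by simp
    \<comment> \<open>Otherwise \<open>before z {z<..x}\<close> counts the displayed
      \<open>z\<close> in the second word, but the first word stops at the displayed
      \<open>x\<close> right after \<open>p\<close>.\<close>
    have "\<exists>l\<in>set (p @ t). l \<in> {z<..x}"
    proof (rule ccontr)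
      assume "\<not> ?thesis"
      then have "set p \<inter> {z<..x} = {}" "set t \<inter> {z<..x} = {}" by auto
      then show False using D(3)[OF zx] zx by (simp add: before_append before_Cons)
    qed
    moreover have "\<exists>l\<in>set q. l \<in> {z..<x}"
    proof (rule ccontr)
      assume "\<not> ?thesis"
      then have q: "set q \<inter> {z..<x} = {}" by auto
      \<comment> \<open>Since \<open>z\<close> occurs in \<open>r\<close>, the first word counts at
        most the \<open>x\<close> inside \<open>r\<close>; the second also counts the
        \<open>x\<close> right after \<open>z\<close>, although \<open>r\<close> and
        \<open>q\<close> contain equally many.\<close>
      have "set r \<inter> {z..<x} \<noteq> {}" if "z \<in> set r" using that zx by auto
      moreover have "z \<in> set r" using rz[of z] ne by (metis add_is_0 count_list_0_iff of_bool_eq_1_iff zero_neq_one)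
      ultimately have "after x {z..<x} (p @ x # r) \<le> count_list r x"
        using after_le[of x _ r] by (simp add: after_append after_Cons)
      moreover have "after x {z..<x} (p @ t @ z # x # q) = Suc (count_list q x)"
        using zx q by (simp add: after_append after_Cons)
      ultimately show False using D(4)[OF zx] rx by simp
    qed
    ultimately show ?thesis using zx by simp
  qed
qed

text \<open>Each swap preserves the invariants, so \<open>swap_allowed\<close> applies again to the
  result. The induction removes letters from the right end of \<open>t\<close> because
  \<open>x\<close> passes the nearest letter first.\<close>

lemma baxt_rel_move:
  assumes "same_invariants (p @ x # r) (p @ t @ x # q)" "x \<notin> set t" "p @ t @ x # q \<in> words n"
  shows "(p @ t @ x # q, p @ x # t @ q) \<in> baxt_rel n"
  using assms
proof (induction t arbitrary: q rule: rev_induct)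
  case Nil
  then show ?case by (simp add: baxt_rel_refl)
next
  case (snoc z t)
  have "z \<noteq> x" using snoc.prems by auto
  from swap_allowed[of p x r t z q] snoc.prems this
  obtain l l' where l: "l \<in> set (p @ t)" "l \<in> {min x z<..max x z}"
    and l': "l' \<in> set q" "l' \<in> {min x z..<max x z}" by auto
  have step: "((p @ t) @ [z, x] @ q, (p @ t) @ [x, z] @ q) \<in> baxt_rel n"
  proof (cases "x < z")
    case True
    then have "((p @ t) @ [x, z] @ q, (p @ t) @ [z, x] @ q) \<in> baxt_rel n"
      by (intro baxt_rel_swap[of x z l _ l']) (use l l' snoc.prems in auto)
    then show ?thesis by (rule baxt_rel_sym)
  next
    case False
    with \<open>z \<noteq> x\<close> show ?thesis
      by (intro baxt_rel_swap[of z x l _ l']) (use l l' snoc.prems in auto)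
  qed
  have "same_invariants (p @ x # r) (p @ t @ x # z # q)"
    using baxt_rel_sound[OF step] snoc.prems(1) by (simp add: same_invariants_def)
  then have "(p @ t @ x # z # q, p @ x # t @ z # q) \<in> baxt_rel n"
    by (rule snoc.IH) (use snoc.prems in auto)
  with step show ?case by (auto intro: baxt_rel_trans)
qed

text \<open>The common prefix \<open>p\<close> grows by one letter per step. It must be carried
  along, since the letters that permit a swap may lie in it.\<close>

lemma baxt_rel_complete:
  assumes "same_invariants (p @ r) (p @ r')" "p @ r \<in> words n" "p @ r' \<in> words n"
  shows "(p @ r, p @ r') \<in> baxt_rel n"
  using assms
proof (induction r arbitrary: p r')
  case Nil
  then have "\<forall>x. count_list r' x = 0"
    unfolding same_invariants_def by simp
  then have "r' = []"
    by (metis count_list_0_iff list.set_intros(1) neq_Nil_conv)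
  with Nil show ?case by (simp add: baxt_rel_refl)
next
  case (Cons x r)
  have "count_list r' x > 0"
    using same_invariantsD(1)[OF Cons.prems(1), of x] by simp
  then have "x \<in> set r'" by (metis count_list_0_iff less_irrefl)
  then obtain t q where r': "r' = t @ x # q" "x \<notin> set t" by (meson split_list_first)
  have mv: "(p @ t @ x # q, p @ x # t @ q) \<in> baxt_rel n"
    by (rule baxt_rel_move) (use Cons.prems r' in auto)
  have "same_invariants ((p @ [x]) @ r) ((p @ [x]) @ t @ q)"
    using baxt_rel_sound[OF mv] Cons.prems(1) r' by (simp add: same_invariants_def)
  then have "((p @ [x]) @ r, (p @ [x]) @ t @ q) \<in> baxt_rel n"
    by (rule Cons.IH) (use Cons.prems r' in auto)
  with mv show ?case unfolding r'
    by (auto intro: baxt_rel_trans baxt_rel_sym)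
qed

theorem baxt_rel_iff:
  "(u, v) \<in> baxt_rel n \<longleftrightarrow> u \<in> words n \<and> v \<in> words n \<and> same_invariants u v"
  using baxt_rel_sound[of u v n] baxt_rel_complete[of "[]" u v n] by auto

subsection \<open>The Baxter monoid with involution\<close>

lemma equiv_baxt_rel: "equiv (words n) (baxt_rel n)"
  by (rule equivI) (auto simp: refl_on_def sym_def trans_def baxt_rel_iff same_invariants_def)

lemma baxt_class_eq_iff:
  assumes "u \<in> words n" "v \<in> words n"
  shows "baxt_class n u = baxt_class n v \<longleftrightarrow> (u, v) \<in> baxt_rel n"
  unfolding baxt_class_def using eq_equiv_class_iff[OF equiv_baxt_rel assms] .

lemma mem_baxt_class: "v \<in> baxt_class n u \<longleftrightarrow> (u, v) \<in> baxt_rel n"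
  by (simp add: baxt_class_def)

text \<open>All representatives give the same product class, and the classes are nonempty, so the
  double union collapses to that class.\<close>

lemma baxt_mult_class:
  assumes "u \<in> words n" "v \<in> words n"
  shows "baxt_class n u \<otimes>\<^bsub>baxt n\<^esub> baxt_class n v = baxt_class n (u @ v)"
proof -
  have eq: "baxt_class n (x @ y) = baxt_class n (u @ v)"
    if "x \<in> baxt_class n u" "y \<in> baxt_class n v" for x y
  proof -
    have "(u @ v, x @ y) \<in> baxt_rel n"
      using that unfolding mem_baxt_class by (rule baxt_rel_append)
    then show ?thesis
      using baxt_class_eq_iff baxt_rel_sound by metis
  qed
  have "(\<Union>x\<in>baxt_class n u. \<Union>y\<in>baxt_class n v. baxt_class n (x @ y))
      = (\<Union>x\<in>baxt_class n u. \<Union>y\<in>baxt_class n v. baxt_class n (u @ v))"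
    by (intro SUP_cong eq) simp_all
  moreover have "u \<in> baxt_class n u" "v \<in> baxt_class n v"
    using assms by (simp_all add: mem_baxt_class baxt_rel_refl)
  ultimately have "(\<Union>x\<in>baxt_class n u. \<Union>y\<in>baxt_class n v. baxt_class n (x @ y)) = baxt_class n (u @ v)"
    by (metis UN_constant empty_iff)
  then show ?thesis by (simp add: baxt_def)
qed

lemma carrier_baxt: "carrier (baxt n) = baxt_class n ` words n"
  by (auto simp: baxt_def baxt_class_def quotient_def)

section \<open>The involution on words and classes\<close>

lemma sharp_word_append: "sharp_word n (u @ v) = sharp_word n v @ sharp_word n u"
  by (simp add: sharp_word_def)

lemma sharp_word_closed: "w \<in> words n \<Longrightarrow> sharp_word n w \<in> words n"
  by (fastforce simp: sharp_word_def)

lemma sharp_word_sharp_word: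
  assumes "w \<in> words n"
  shows "sharp_word n (sharp_word n w) = w"
  using assms by (simp add: sharp_word_def rev_map) (intro map_idI, auto)

text \<open>The involution reverses both the word and the alphabet. The swapped pair becomes
  \<open>?s d < ?s a\<close>, the outer letters change sides, and the conditions
  \<open>{a<..d}\<close> and \<open>{a..<d}\<close> are interchanged accordingly.\<close>

lemma baxt_rel_sharp_word:
  assumes "(u, v) \<in> baxt_rel n"
  shows "(sharp_word n u, sharp_word n v) \<in> baxt_rel n"
  using assms unfolding baxt_rel_def
proof (induction rule: generated_congruence.induct)
  case (gen u v)
  note w = gen.hyps(2,3)[THEN sharp_word_closed]
  let ?s = "\<lambda>i. n + 1 - i"
  have "(sharp_word n u, sharp_word n v) \<in> baxt_rel n"
    using gen.hyps(1) unfolding baxt_pairs_def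
  proof (elim UnE CollectE exE conjE)
    fix a b c d p q
    assume "(u, v) = ([c] @ p @ [a, d] @ q @ [b], [c] @ p @ [d, a] @ q @ [b])"
      and *: "{a, b, c, d} \<subseteq> {1..n}" "a \<le> b" "b < c" "c \<le> d"
    then have uv: "sharp_word n u = (?s b # sharp_word n q) @ [?s d, ?s a] @ sharp_word n p @ [?s c]"
      "sharp_word n v = (?s b # sharp_word n q) @ [?s a, ?s d] @ sharp_word n p @ [?s c]"
      by (simp_all add: sharp_word_def)
    show ?thesis
      unfolding uv by (rule baxt_rel_swap[where l = "?s b" and r = "?s c", OF _ _ _ _ _ w(1)[unfolded uv]]) (use * in auto)
  next
    fix a b c d p q
    assume "(u, v) = ([b] @ p @ [d, a] @ q @ [c], [b] @ p @ [a, d] @ q @ [c])"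
      and *: "{a, b, c, d} \<subseteq> {1..n}" "a < b" "b \<le> c" "c < d"
    then have uv: "sharp_word n u = (?s c # sharp_word n q) @ [?s a, ?s d] @ sharp_word n p @ [?s b]"
      "sharp_word n v = (?s c # sharp_word n q) @ [?s d, ?s a] @ sharp_word n p @ [?s b]"
      by (simp_all add: sharp_word_def)
    have "(sharp_word n v, sharp_word n u) \<in> baxt_rel n"
      unfolding uv by (rule baxt_rel_swap[where l = "?s c" and r = "?s b", OF _ _ _ _ _ w(2)[unfolded uv]]) (use * in auto)
    then show ?thesis by (rule baxt_rel_sym)
  qed
  then show ?case by (simp add: baxt_rel_def)
next
  case (refl w)
  then show ?case by (intro generated_congruence.refl sharp_word_closed)
qed (auto simp: sharp_word_append intro: generated_congruence.intros(3-5))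

lemma sharp_baxt_class:
  assumes "w \<in> words n"
  shows "sharp n (baxt_class n w) = baxt_class n (sharp_word n w)"
proof -
  have "baxt_class n (sharp_word n x) = baxt_class n (sharp_word n w)" if "x \<in> baxt_class n w" for x
    using that baxt_rel_sharp_word baxt_class_eq_iff baxt_rel_sound unfolding mem_baxt_class by metis
  moreover have "w \<in> baxt_class n w"
    using assms by (simp add: mem_baxt_class baxt_rel_refl)
  ultimately show ?thesis
    unfolding sharp_def by blast
qed

theorem involution_monoid_baxt: "involution_monoid (baxt n) (sharp n)"
proof
  have one: "\<one>\<^bsub>baxt n\<^esub> = baxt_class n []" by (simp add: baxt_def)
  fix x y assume x: "x \<in> carrier (baxt n)"
  then obtain u where u: "u \<in> words n" "x = baxt_class n u" unfolding carrier_baxt by blast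
  show "\<one>\<^bsub>baxt n\<^esub> \<otimes>\<^bsub>baxt n\<^esub> x = x" "x \<otimes>\<^bsub>baxt n\<^esub> \<one>\<^bsub>baxt n\<^esub> = x"
    using u by (simp_all add: one baxt_mult_class)
  show "sharp n x \<in> carrier (baxt n)" "sharp n (sharp n x) = x"
    using u by (simp_all add: sharp_baxt_class sharp_word_closed sharp_word_sharp_word carrier_baxt del: One_nat_def)
  assume "y \<in> carrier (baxt n)"
  then obtain v where v: "v \<in> words n" "y = baxt_class n v" unfolding carrier_baxt by blast
  show "x \<otimes>\<^bsub>baxt n\<^esub> y \<in> carrier (baxt n)"
    using u v by (simp add: baxt_mult_class carrier_baxt)
  show "sharp n (x \<otimes>\<^bsub>baxt n\<^esub> y) = sharp n y \<otimes>\<^bsub>baxt n\<^esub> sharp n x"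
    using u v by (simp add: baxt_mult_class sharp_baxt_class sharp_word_append sharp_word_closed
        del: One_nat_def)
  fix z assume "z \<in> carrier (baxt n)"
  then obtain w where w: "w \<in> words n" "z = baxt_class n w" unfolding carrier_baxt by blast
  show "x \<otimes>\<^bsub>baxt n\<^esub> y \<otimes>\<^bsub>baxt n\<^esub> z = x \<otimes>\<^bsub>baxt n\<^esub> (y \<otimes>\<^bsub>baxt n\<^esub> z)"
    using u v w by (simp add: baxt_mult_class)
qed (simp add: carrier_baxt, simp add: baxt_def)

subsection \<open>Block diagonal matrices\<close>

text \<open>The explicit list of sizes fixes the position of every block, so that products,
  comparison and reversal can be carried out blockwise.\<close>

definition square_blocks :: "'a mat list \<Rightarrow> nat list \<Rightarrow> bool" where
  "square_blocks As ns \<longleftrightarrow> list_all2 (\<lambda>A n. A \<in> carrier_mat n n) As ns"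

lemma square_blocks_simps [simp]:
  "square_blocks [] []"
  "square_blocks (A # As) (n # ns) \<longleftrightarrow> A \<in> carrier_mat n n \<and> square_blocks As ns"
  "square_blocks As [] \<longleftrightarrow> As = []"
  "square_blocks As (n # ns) \<longleftrightarrow> (\<exists>A As'. As = A # As' \<and> A \<in> carrier_mat n n \<and> square_blocks As' ns)"
  by (auto simp: square_blocks_def list_all2_Cons2)

lemma diag_block_mat_carrier:
  "square_blocks As ns \<Longrightarrow> diag_block_mat As \<in> carrier_mat (sum_list ns) (sum_list ns)"
  by (induction ns arbitrary: As) (auto simp: Let_def)

lemma diag_block_mat_Cons:
  assumes "A \<in> carrier_mat n n" "square_blocks As ns"
  shows "diag_block_mat (A # As)
    = four_block_mat A (0\<^sub>m n (sum_list ns)) (0\<^sub>m (sum_list ns) n) (diag_block_mat As)"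
  using assms diag_block_mat_carrier[OF assms(2)] by (simp add: Let_def)

text \<open>The shape of the product is proved in the same induction because
  \<open>diag_block_mat_Cons\<close> needs it for the tail.\<close>

lemma diag_block_mat_mult:
  fixes As Bs :: "'a :: comm_semiring_1 mat list"
  assumes "square_blocks As ns" "square_blocks Bs ns"
  shows "diag_block_mat As * diag_block_mat Bs = diag_block_mat (map2 (*) As Bs)
    \<and> square_blocks (map2 (*) As Bs) ns"
  using assms
proof (induction ns arbitrary: As Bs)
  case Nil
  then show ?case by simp
next
  case (Cons n ns)
  then obtain A As' B Bs' where AB: "As = A # As'" "Bs = B # Bs'"
    and A: "A \<in> carrier_mat n n" "square_blocks As' ns"
    and B: "B \<in> carrier_mat n n" "square_blocks Bs' ns" by auto
  let ?N = "sum_list ns"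
  note IH = Cons.IH[OF A(2) B(2)]
  note car = diag_block_mat_carrier[OF A(2)] diag_block_mat_carrier[OF B(2)]
  have AB': "A * B \<in> carrier_mat n n" using A(1) B(1) by simp
  have "diag_block_mat As * diag_block_mat Bs
      = four_block_mat (A * B + 0\<^sub>m n ?N * 0\<^sub>m ?N n) (A * 0\<^sub>m n ?N + 0\<^sub>m n ?N * diag_block_mat Bs')
          (0\<^sub>m ?N n * B + diag_block_mat As' * 0\<^sub>m ?N n)
          (0\<^sub>m ?N n * 0\<^sub>m n ?N + diag_block_mat As' * diag_block_mat Bs')"
    unfolding AB diag_block_mat_Cons[OF A] diag_block_mat_Cons[OF B]
    by (rule mult_four_block_mat) (use A(1) B(1) car in auto)
  also have "\<dots> = four_block_mat (A * B) (0\<^sub>m n ?N) (0\<^sub>m ?N n) (diag_block_mat As' * diag_block_mat Bs')"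
    using A(1) B(1) car by (intro cong_four_block_mat) auto
  also have "\<dots> = diag_block_mat ((A * B) # map2 (*) As' Bs')"
    by (simp only: diag_block_mat_Cons[OF AB' IH[THEN conjunct2]] IH[THEN conjunct1])
  finally show ?case using IH AB' by (simp add: AB)
qed

lemma four_block_mat_inject:
  assumes "four_block_mat A B C D = four_block_mat A' B' C' D'"
    and "A \<in> carrier_mat nr1 nc1" "A' \<in> carrier_mat nr1 nc1"
    and "D \<in> carrier_mat nr2 nc2" "D' \<in> carrier_mat nr2 nc2"
  shows "A = A' \<and> D = D'"
proof (intro conjI eq_matI)
  fix i j
  have eq: "four_block_mat A B C D $$ ij = four_block_mat A' B' C' D' $$ ij" for ij
    using assms(1) by simp
  show "A $$ (i, j) = A' $$ (i, j)" if "i < dim_row A'" "j < dim_col A'"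
    using eq[of "(i, j)"] that assms(2-) by simp
  show "D $$ (i, j) = D' $$ (i, j)" if "i < dim_row D'" "j < dim_col D'"
    using eq[of "(nr1 + i, nc1 + j)"] that assms(2-) by simp
qed (use assms(2-) in auto)

lemma diag_block_mat_inject:
  assumes "square_blocks As ns" "square_blocks Bs ns" "diag_block_mat As = diag_block_mat Bs"
  shows "As = Bs"
  using assms
proof (induction ns arbitrary: As Bs)
  case (Cons n ns)
  then obtain A As' B Bs' where AB: "As = A # As'" "Bs = B # Bs'"
    and A: "A \<in> carrier_mat n n" "square_blocks As' ns"
    and B: "B \<in> carrier_mat n n" "square_blocks Bs' ns" by auto
  have "A = B \<and> diag_block_mat As' = diag_block_mat Bs'"
    using Cons.prems(3) unfolding AB diag_block_mat_Cons[OF A] diag_block_mat_Cons[OF B]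
    by (rule four_block_mat_inject[OF _ A(1) B(1) diag_block_mat_carrier[OF A(2)] diag_block_mat_carrier[OF B(2)]])
  then show ?case using Cons.IH[OF A(2) B(2)] AB by simp
qed simp

lemma upper_triangular_diag_block_mat:
  assumes "square_blocks As ns" "\<forall>A\<in>set As. upper_triangular A"
  shows "upper_triangular (diag_block_mat As)"
  using assms
proof (induction ns arbitrary: As)
  case (Cons n ns)
  then obtain A As' where AB: "As = A # As'"
    and A: "A \<in> carrier_mat n n" "square_blocks As' ns" by auto
  have "upper_triangular (diag_block_mat As')" using Cons AB A by simp
  then show ?case
    using Cons.prems(2) A(1) diag_block_mat_carrier[OF A(2)]
    unfolding AB diag_block_mat_Cons[OF A] by (auto simp: upper_triangular_def)
qed (simp add: upper_triangular_def)

subsection \<open>Skew transposition\<close>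

lemma skew_transpose_carrier [simp]: "skew_transpose m A \<in> carrier_mat m m"
  by (simp add: skew_transpose_def)

lemma skew_transpose_skew_transpose:
  "A \<in> carrier_mat m m \<Longrightarrow> skew_transpose m (skew_transpose m A) = A"
  by (rule eq_matI) (auto simp: skew_transpose_def)

lemma skew_transpose_one: "skew_transpose m (1\<^sub>m m) = 1\<^sub>m m"
  by (rule eq_matI) (auto simp: skew_transpose_def)

lemma skew_transpose_mult:
  fixes A B :: "'a :: comm_semiring_1 mat"
  assumes A: "A \<in> carrier_mat m m" and B: "B \<in> carrier_mat m m"
  shows "skew_transpose m (A * B) = skew_transpose m B * skew_transpose m A"
proof (rule eq_matI)
  fix i j assume "i < dim_row (skew_transpose m B * skew_transpose m A)"
    "j < dim_col (skew_transpose m B * skew_transpose m A)"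
  then have ij: "i < m" "j < m" by (simp_all add: skew_transpose_def)
  have "skew_transpose m (A * B) $$ (i, j)
      = (\<Sum>k<m. A $$ (m - 1 - j, k) * B $$ (k, m - 1 - i))"
    using A B ij by (simp add: skew_transpose_def scalar_prod_def atLeast0LessThan)
  \<comment> \<open>Reversing the summation index produces the entries of the two skew transposes;
    commutativity then exchanges the factors.\<close>
  also have "\<dots> = (\<Sum>k<m. A $$ (m - 1 - j, m - 1 - k) * B $$ (m - 1 - k, m - 1 - i))"
    by (subst sum.nat_diff_reindex[symmetric]) simp
  also have "\<dots> = (skew_transpose m B * skew_transpose m A) $$ (i, j)"
    using A B ij by (simp add: skew_transpose_def scalar_prod_def atLeast0LessThan mult.commute)
  finally show "skew_transpose m (A * B) $$ (i, j)
      = (skew_transpose m B * skew_transpose m A) $$ (i, j)" .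
qed (use assms in \<open>simp_all add: skew_transpose_def\<close>)

lemma upper_triangular_skew_transpose:
  assumes "A \<in> carrier_mat m m" "upper_triangular A"
  shows "upper_triangular (skew_transpose m A)"
  using assms by (auto simp: upper_triangular_def skew_transpose_def)

lemma upper_triangular_mult:
  fixes A B :: "'a :: semiring_0 mat"
  assumes "A \<in> carrier_mat m m" "B \<in> carrier_mat m m" "upper_triangular A" "upper_triangular B"
  shows "upper_triangular (A * B)"
proof -
  \<comment> \<open>For \<open>k < i\<close> the factor from \<open>A\<close> is below the diagonal,
    and for \<open>i \<le> k\<close> the one from \<open>B\<close> is, since
    \<open>j < i\<close>.\<close>
  have "A $$ (i, k) * B $$ (k, j) = 0" if "i < m" "j < i" "k < m" for i j k
    using assms that by (cases "k < i") (auto simp: upper_triangular_def)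
  then show ?thesis
    using assms(1,2) by (auto simp: upper_triangular_def scalar_prod_def intro!: sum.neutral)
qed

theorem involution_monoid_UT:
  "involution_monoid (UT m :: 'a :: comm_semiring_1 mat monoid) (skew_transpose m)"
  by unfold_locales
    (auto simp: UT_def upper_triangular_mult upper_triangular_skew_transpose skew_transpose_mult
      skew_transpose_skew_transpose)

lemma skew_transpose_four_block_mat:
  assumes "A \<in> carrier_mat n n" "D \<in> carrier_mat m m"
  shows "skew_transpose (n + m) (four_block_mat A (0\<^sub>m n m) (0\<^sub>m m n) D)
    = four_block_mat (skew_transpose m D) (0\<^sub>m m n) (0\<^sub>m n m) (skew_transpose n A)"
  by (rule eq_matI) (use assms in \<open>auto simp: skew_transpose_def\<close>)

lemma diag_block_mat_snoc:
  assumes "B \<in> carrier_mat n n" "square_blocks As ns"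
  shows "diag_block_mat (As @ [B])
    = four_block_mat (diag_block_mat As) (0\<^sub>m (sum_list ns) n) (0\<^sub>m n (sum_list ns)) B"
  using assms diag_block_mat_carrier[OF assms(2)] by (simp add: diag_block_mat_last Let_def)

text \<open>Reflection in the antidiagonal sends the first block to the last place, so splitting off
  the head of \<open>As\<close> corresponds to \<open>diag_block_mat_snoc\<close> on the reflected
  side.\<close>

lemma skew_transpose_diag_block_mat:
  assumes "square_blocks As ns"
  shows "skew_transpose (sum_list ns) (diag_block_mat As)
      = diag_block_mat (rev (map2 skew_transpose ns As))
    \<and> square_blocks (rev (map2 skew_transpose ns As)) (rev ns)"
  using assms
proof (induction ns arbitrary: As)
  case Nil
  then show ?case by (auto simp: skew_transpose_def intro: eq_matI)
next
  case (Cons n ns)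
  then obtain A As' where As: "As = A # As'"
    and A: "A \<in> carrier_mat n n" "square_blocks As' ns" by auto
  let ?R = "rev (map2 skew_transpose ns As')"
  note IH = Cons.IH[OF A(2)]
  have sq: "square_blocks (?R @ [skew_transpose n A]) (rev ns @ [n])"
    using IH unfolding square_blocks_def by (intro list_all2_appendI) auto
  have "skew_transpose (sum_list (n # ns)) (diag_block_mat As)
      = four_block_mat (skew_transpose (sum_list ns) (diag_block_mat As')) (0\<^sub>m (sum_list ns) n)
          (0\<^sub>m n (sum_list ns)) (skew_transpose n A)"
    unfolding As diag_block_mat_Cons[OF A]
    using skew_transpose_four_block_mat[OF A(1) diag_block_mat_carrier[OF A(2)]] by simp
  also have "\<dots> = diag_block_mat (?R @ [skew_transpose n A])"
    using IH by (subst diag_block_mat_snoc[of _ n _ "rev ns"]) simp_all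
  finally show ?case using sq by (simp add: As)
qed

section \<open>Explicit blocks of size one and two\<close>

abbreviation mat2 :: "'a \<Rightarrow> 'a \<Rightarrow> 'a \<Rightarrow> 'a \<Rightarrow> 'a mat" where
  "mat2 a b c d \<equiv> mat_of_rows_list 2 [[a, b], [c, d]]"

lemma mat2_carrier [simp]: "mat2 a b c d \<in> carrier_mat 2 2"
  by (rule carrier_matI) (simp_all add: mat_of_rows_list_def)

lemma mat2_entries:
  "mat2 a b c d $$ (0, 0) = a" "mat2 a b c d $$ (0, Suc 0) = b"
  "mat2 a b c d $$ (Suc 0, 0) = c" "mat2 a b c d $$ (Suc 0, Suc 0) = d"
  by (simp_all add: mat_of_rows_list_def)

lemma eq_mat2I:
  assumes "A \<in> carrier_mat 2 2" "A $$ (0, 0) = a" "A $$ (0, Suc 0) = b"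
    "A $$ (Suc 0, 0) = c" "A $$ (Suc 0, Suc 0) = d"
  shows "A = mat2 a b c d"
proof (rule eq_matI)
  fix i j assume "i < dim_row (mat2 a b c d)" "j < dim_col (mat2 a b c d)"
  then have "i = 0 \<or> i = Suc 0" "j = 0 \<or> j = Suc 0"
    by (auto simp: mat_of_rows_list_def)
  then show "A $$ (i, j) = mat2 a b c d $$ (i, j)"
    using assms by (auto simp: mat2_entries)
qed (use assms(1) in \<open>auto simp: mat_of_rows_list_def\<close>)

lemma mat2_mult:
  fixes a :: "'a :: comm_semiring_1"
  shows "mat2 a b c d * mat2 a' b' c' d'
    = mat2 (a * a' + b * c') (a * b' + b * d') (c * a' + d * c') (c * b' + d * d')"
  by (rule eq_mat2I) (auto simp: mat_of_rows_list_def scalar_prod_def numeral_2_eq_2)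

lemma one_mat_2: "1\<^sub>m 2 = mat2 1 0 0 (1 :: 'a :: comm_semiring_1)"
  by (rule eq_mat2I) auto

lemma skew_transpose_mat2: "skew_transpose 2 (mat2 a b c d) = mat2 d b c a"
  by (rule eq_mat2I) (auto simp: skew_transpose_def mat_of_rows_list_def)

lemma upper_triangular_mat2: "upper_triangular (mat2 a b 0 d)"
  by (auto simp: upper_triangular_def mat_of_rows_list_def numeral_2_eq_2 less_Suc_eq)

text \<open>These rules are stated for \<open>Suc 0\<close> because the simplifier rewrites the dimension of
  \<^term>\<open>scalar_block\<close> to this form.\<close>

lemma scalar_block_carrier [simp]: "mat_of_rows_list (Suc 0) [[x]] \<in> carrier_mat (Suc 0) (Suc 0)"
  by (simp add: mat_of_rows_list_def)

lemma scalar_block_mult: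
  fixes x y :: "'a :: comm_semiring_1"
  shows "mat_of_rows_list (Suc 0) [[x]] * mat_of_rows_list (Suc 0) [[y]]
    = mat_of_rows_list (Suc 0) [[x * y]]"
  by (rule eq_matI) (auto simp: mat_of_rows_list_def scalar_prod_def)

lemma scalar_block_inject:
  "mat_of_rows_list (Suc 0) [[x]] = mat_of_rows_list (Suc 0) [[y]] \<longleftrightarrow> x = y"
proof
  assume "mat_of_rows_list (Suc 0) [[x]] = mat_of_rows_list (Suc 0) [[y]]"
  then have "mat_of_rows_list (Suc 0) [[x]] $$ (0, 0) = mat_of_rows_list (Suc 0) [[y]] $$ (0, 0)" by simp
  then show "x = y" by (simp add: mat_of_rows_list_def)
qed simp

lemma skew_transpose_scalar_block:
  "skew_transpose (Suc 0) (mat_of_rows_list (Suc 0) [[x]]) = mat_of_rows_list (Suc 0) [[x]]"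
  by (rule eq_matI) (auto simp: skew_transpose_def mat_of_rows_list_def)

lemma upper_triangular_scalar_block: "upper_triangular (mat_of_rows_list (Suc 0) [[x]])"
  by (auto simp: upper_triangular_def mat_of_rows_list_def)

subsection \<open>The representation\<close>

text \<open>These are the products \<open>P^k\<close> and \<open>P^k K\<close>; the flag
  \<open>e\<close> tells whether a stopping letter has occurred.\<close>

definition PK_block :: "'a :: comm_semiring_1 \<Rightarrow> nat \<Rightarrow> bool \<Rightarrow> 'a mat" where
  "PK_block s k e = (if e then mat2 0 (s ^ k) 0 1 else mat2 (s ^ k) 0 0 1)"

text \<open>These are the products \<open>Q^k\<close> and \<open>J Q^k\<close>, with the same
  meaning of \<open>e\<close>.\<close>

definition JQ_block :: "'a :: comm_semiring_1 \<Rightarrow> nat \<Rightarrow> bool \<Rightarrow> 'a mat" where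
  "JQ_block s k e = (if e then mat2 1 (s ^ k) 0 0 else mat2 1 0 0 (s ^ k))"

lemma PK_block_carrier [simp]: "PK_block s k e \<in> carrier_mat 2 2"
  by (simp add: PK_block_def)

lemma JQ_block_carrier [simp]: "JQ_block s k e \<in> carrier_mat 2 2"
  by (simp add: JQ_block_def)

lemma PK_block_mult:
  "matP s * PK_block s k e = PK_block s (Suc k) e"
  "matK * PK_block s k e = PK_block s 0 True"
  "1\<^sub>m 2 * PK_block s k e = PK_block s k e"
  by (auto simp: PK_block_def matP_def matK_def one_mat_2 mat2_mult)

text \<open>Words grow on the left, so once a stopping letter has been read the exponent of
  \<open>after\<close> is frozen: \<open>J\<close> absorbs \<open>Q\<close> from the left. In
  contrast, \<open>K\<close> resets the exponent of \<open>before\<close>.\<close>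

lemma JQ_block_mult:
  "matQ s * JQ_block s k e = JQ_block s (if e then k else Suc k) e"
  "matJ * JQ_block s k e = JQ_block s k True"
  "1\<^sub>m 2 * JQ_block s k e = JQ_block s k e"
  by (auto simp: JQ_block_def matQ_def matJ_def one_mat_2 mat2_mult)

text \<open>The order is symmetric about the middle: mirrored positions hold invariants that
  exchanging 1 with 3 and \<open>before\<close> with \<open>after\<close> turns into each
  other.\<close>

definition word_blocks :: "'a :: comm_semiring_1 \<Rightarrow> nat list \<Rightarrow> 'a mat list" where
  "word_blocks s w =
    [scalar_block (s ^ count_list w 1),
     PK_block s (before 1 {1<..3} w) (set w \<inter> {1<..3} \<noteq> {}),
     PK_block s (before 1 {1<..2} w) (set w \<inter> {1<..2} \<noteq> {}),
     PK_block s (before 2 {2<..3} w) (set w \<inter> {2<..3} \<noteq> {}),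
     scalar_block (s ^ count_list w 2),
     JQ_block s (after 2 {1..<2} w) (set w \<inter> {1..<2} \<noteq> {}),
     JQ_block s (after 3 {2..<3} w) (set w \<inter> {2..<3} \<noteq> {}),
     JQ_block s (after 3 {1..<3} w) (set w \<inter> {1..<3} \<noteq> {}),
     scalar_block (s ^ count_list w 3)]"

definition letter_blocks :: "'a :: comm_semiring_1 \<Rightarrow> nat \<Rightarrow> 'a mat list" where
  "letter_blocks s i =
     (if i = 1 then
        [scalar_block s, matP s, matP s, 1\<^sub>m 2, scalar_block 1, matJ, 1\<^sub>m 2, matJ, scalar_block 1]
      else if i = 2 then
        [scalar_block 1, matK, matK, matP s, scalar_block s, matQ s, matJ, matJ, scalar_block 1]
      else
        [scalar_block 1, matK, 1\<^sub>m 2, matK, scalar_block 1, 1\<^sub>m 2, matQ s, matQ s, scalar_block s])"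

definition block_sizes :: "nat list" where
  "block_sizes = [1, 2, 2, 2, 1, 2, 2, 2, 1]"

lemma phi3_letter_eq: "phi3_letter s i = diag_block_mat (letter_blocks s i)"
  by (simp only: phi3_letter_def letter_blocks_def)

lemma square_blocks_letter_blocks: "square_blocks (letter_blocks s i) block_sizes"
  by (simp add: letter_blocks_def block_sizes_def matP_def matQ_def matJ_def matK_def)

lemma square_blocks_word_blocks: "square_blocks (word_blocks s w) block_sizes"
  by (simp add: word_blocks_def block_sizes_def)

text \<open>In each 2 by 2 block the counted letter acts by \<open>P\<close> or \<open>Q\<close>,
  the letters of the interval by \<open>K\<close> or \<open>J\<close>, and any other letter by the
  identity.\<close>

lemma word_blocks_Cons:
  assumes "i \<in> {1..3}"
  shows "map2 (*) (letter_blocks s i) (word_blocks s w) = word_blocks s (i # w)"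
proof -
  consider "i = 1" | "i = 2" | "i = 3" using assms by fastforce
  then show ?thesis
    by cases (simp_all add: letter_blocks_def word_blocks_def PK_block_mult JQ_block_mult
        scalar_block_mult before_Cons after_Cons_Suc mult.commute)
qed

lemma word_blocks_Nil: "diag_block_mat (word_blocks s []) = 1\<^sub>m 15"
proof -
  have "scalar_block 1 = (1\<^sub>m 1 :: 'a mat)"
    by (rule eq_matI) (auto simp: mat_of_rows_list_def)
  then have "word_blocks s [] = map one_mat block_sizes"
    by (simp add: word_blocks_def block_sizes_def PK_block_def JQ_block_def one_mat_2)
  moreover have "diag_block_mat (map one_mat ns) = (1\<^sub>m (sum_list ns) :: 'a mat)" for ns
    by (induction ns) (auto simp: Let_def)
  moreover have "sum_list block_sizes = 15" by (simp add: block_sizes_def)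
  ultimately show ?thesis by simp
qed

section \<open>Homomorphism property and compatibility with the involutions\<close>

lemma phi3_Nil: "phi3 s [] = 1\<^sub>m 15"
  by (simp add: phi3_def word_hom_def UT_def)

lemma phi3_Cons: "phi3 s (i # w) = phi3_letter s i * phi3 s w"
  by (simp add: phi3_def word_hom_def UT_def)

lemma phi3_letter_carrier:
  fixes s :: "'a :: comm_semiring_1"
  shows "phi3_letter s i \<in> carrier (UT 15)"
proof -
  have "\<forall>A\<in>set (letter_blocks s i). upper_triangular A"
    by (auto simp: letter_blocks_def matP_def matQ_def matJ_def matK_def
        upper_triangular_mat2 upper_triangular_scalar_block)
  then show ?thesis
    using diag_block_mat_carrier[OF square_blocks_letter_blocks, of s i]
      upper_triangular_diag_block_mat[OF square_blocks_letter_blocks, of s i]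
    by (simp add: UT_def phi3_letter_eq block_sizes_def)
qed

interpretation UT: involution_monoid "UT m :: 'a :: comm_semiring_1 mat monoid" "skew_transpose m" for m
  by (rule involution_monoid_UT)

lemma UT_simps: "x \<otimes>\<^bsub>UT m\<^esub> y = x * y" "\<one>\<^bsub>UT m\<^esub> = 1\<^sub>m m"
  by (simp_all add: UT_def)

lemma phi3_closed: "phi3 s w \<in> carrier (UT 15)"
proof (induction w)
  case Nil
  then show ?case using UT.one_closed[of 15] by (simp add: phi3_Nil UT_simps)
next
  case (Cons i w)
  then show ?case using UT.m_closed[OF phi3_letter_carrier Cons] by (simp add: phi3_Cons UT_simps)
qed

lemma phi3_append: "phi3 s (u @ v) = phi3 s u * phi3 s v"
proof (induction u)
  case Nil
  then show ?case using UT.l_one[OF phi3_closed, of s v] by (simp add: phi3_Nil UT_simps)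
next
  case (Cons i u)
  then show ?case
    using UT.m_assoc[OF phi3_letter_carrier phi3_closed phi3_closed, of s i s u s v] by (simp add: phi3_Cons UT_simps)
qed

lemma phi3_eq_diag_block_mat:
  "w \<in> words 3 \<Longrightarrow> phi3 s w = diag_block_mat (word_blocks s w)"
proof (induction w)
  case Nil
  then show ?case by (simp add: phi3_Nil word_blocks_Nil)
next
  case (Cons i w)
  then have "phi3 s (i # w) = diag_block_mat (letter_blocks s i) * diag_block_mat (word_blocks s w)"
    by (simp add: phi3_Cons phi3_letter_eq)
  also have "\<dots> = diag_block_mat (map2 (*) (letter_blocks s i) (word_blocks s w))"
    using diag_block_mat_mult[OF square_blocks_letter_blocks square_blocks_word_blocks] by blast
  also have "map2 (*) (letter_blocks s i) (word_blocks s w) = word_blocks s (i # w)"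
    by (rule word_blocks_Cons) (use Cons.prems in auto)
  finally show ?case .
qed

text \<open>Skew transposition exchanges \<open>P\<close> with \<open>Q\<close> and \<open>J\<close>
  with \<open>K\<close>, and \<open>block_sizes\<close> is a palindrome; \<open>4 - i\<close> is the
  image of the letter under the involution for \<open>n = 3\<close>.\<close>

lemma skew_transpose_phi3_letter:
  assumes "i \<in> {1..3}"
  shows "skew_transpose 15 (phi3_letter s i) = phi3_letter s (4 - i)"
proof -
  consider "i = 1" | "i = 2" | "i = 3" using assms by fastforce
  then have "rev (map2 skew_transpose block_sizes (letter_blocks s i)) = letter_blocks s (4 - i)"
    by cases (simp_all add: block_sizes_def letter_blocks_def matP_def matQ_def matJ_def matK_def
        skew_transpose_mat2 skew_transpose_scalar_block skew_transpose_one)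
  then show ?thesis
    using skew_transpose_diag_block_mat[OF square_blocks_letter_blocks, of s i]
    by (simp add: phi3_letter_eq block_sizes_def)
qed

text \<open>Both sides reverse products, so agreement on letters suffices.\<close>

lemma phi3_sharp_word:
  assumes "w \<in> words 3"
  shows "phi3 s (sharp_word 3 w) = skew_transpose 15 (phi3 s w)"
  using assms
proof (induction w)
  case Nil
  then show ?case by (simp add: sharp_word_def phi3_Nil skew_transpose_one)
next
  case (Cons i w)
  then have i: "i \<in> {1..3}" by auto
  have single: "phi3 s [j] = phi3_letter s j" for j
    using UT.r_one[OF phi3_letter_carrier] by (simp add: phi3_Cons phi3_Nil UT_simps)
  have "phi3 s (sharp_word 3 (i # w)) = phi3 s (sharp_word 3 w) * phi3_letter s (4 - i)"
    by (simp add: sharp_word_def phi3_append single)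
  also have "\<dots> = skew_transpose 15 (phi3 s w) * skew_transpose 15 (phi3_letter s i)"
    using Cons i by (simp add: skew_transpose_phi3_letter)
  also have "\<dots> = skew_transpose 15 (phi3_letter s i * phi3 s w)"
    using UT.star_mult[OF phi3_letter_carrier phi3_closed, of s i s w] by (simp add: UT_simps)
  finally show ?case by (simp add: phi3_Cons)
qed

section \<open>Faithfulness\<close>

lemma word_blocks_cong:
  assumes "same_invariants u v"
  shows "word_blocks s u = word_blocks s v"
  unfolding word_blocks_def same_invariantsD(1,2)[OF assms]
  by (simp add: same_invariantsD(3,4)[OF assms])

lemma word_blocks_inject:
  assumes inf: "\<And>i j :: nat. s ^ i = s ^ j \<longleftrightarrow> i = j"
    and uv: "u \<in> words 3" "v \<in> words 3" and eq: "word_blocks s u = word_blocks s v"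
  shows "same_invariants u v"
proof (rule same_invariants_words[OF uv])
  have letters: "x = 1 \<or> x = 2 \<or> x = 3" if "x \<in> {1..3}" for x :: nat using that by fastforce
  have cnt: "count_list u x = count_list v x" if "x \<in> {1, 2, 3}" for x
    using eq that by (auto simp: word_blocks_def scalar_block_inject inf)
  then show "count_list u x = count_list v x" if "x \<in> {1..3}" for x
    using letters[OF that] by auto
  have "count_list u x = count_list v x" for x
  proof (cases "x \<in> {1..3}")
    case True
    with letters[OF this] cnt show ?thesis by auto
  next
    case False
    with uv have "x \<notin> set u" "x \<notin> set v" by auto
    then show ?thesis by (simp add: count_list_0_iff[THEN iffD2])
  qed
  \<comment> \<open>The scalar blocks determine the letter sets, hence the flags of all remaining
    blocks. Exponents can then be compared under a common flag.\<close>
  then have set: "set u = set v"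
    by (metis count_list_0_iff subsetI subset_antisym)
  \<comment> \<open>The power of \<open>s\<close> sits in entry \<open>(0, 1)\<close> if the flag is
    set and in \<open>(0, 0)\<close> otherwise.\<close>
  have PK: "k = l" if "PK_block s k e = PK_block s l e" for k l e
  proof -
    have "PK_block s k e $$ ij = PK_block s l e $$ ij" for ij using that by simp
    from this[of "(0, Suc 0)"] this[of "(0, 0)"] show ?thesis
      by (auto simp: PK_block_def mat2_entries inf split: if_splits)
  qed
  have JQ: "k = l" if "JQ_block s k e = JQ_block s l e" for k l e
  proof -
    have "JQ_block s k e $$ ij = JQ_block s l e $$ ij" for ij using that by simp
    from this[of "(0, Suc 0)"] this[of "(Suc 0, Suc 0)"] show ?thesis
      by (auto simp: JQ_block_def mat2_entries inf split: if_splits)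
  qed
  fix a d :: nat assume "1 \<le> a" "a < d" "d \<le> 3"
  then have ad: "a = 1 \<and> d = 3 \<or> a = 1 \<and> d = 2 \<or> a = 2 \<and> d = 3" by linarith
  show "before a {a<..d} u = before a {a<..d} v"
    using eq ad PK unfolding word_blocks_def set by blast
  show "after d {a..<d} u = after d {a..<d} v"
    using eq ad JQ unfolding word_blocks_def set by blast
qed

text \<open>From right to left this makes the induced map well defined on classes, from left to
  right injective.\<close>

lemma phi3_eq_iff:
  assumes "\<And>i j :: nat. s ^ i = s ^ j \<longleftrightarrow> i = j" and uv: "u \<in> words 3" "v \<in> words 3"
  shows "phi3 s u = phi3 s v \<longleftrightarrow> (u, v) \<in> baxt_rel 3"
  unfolding baxt_rel_iff phi3_eq_diag_block_mat[OF uv(1)] phi3_eq_diag_block_mat[OF uv(2)]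
  using word_blocks_inject[OF assms] word_blocks_cong uv
    diag_block_mat_inject[OF square_blocks_word_blocks square_blocks_word_blocks]
  by metis

theorem theorem3p2:
  fixes s :: "'s::comm_semiring_1"
  assumes add_idem: "\<And>a :: 's. a + a = a"
    and infinite_order: "\<And>i j :: nat. s ^ i = s ^ j \<longleftrightarrow> i = j"
  shows "involution_monoid (baxt 3) (sharp 3)
    \<and> involution_monoid (UT 15 :: 's mat monoid) (skew_transpose 15)
    \<and> (\<exists>\<Phi>. (\<forall>w\<in>words 3. \<Phi> (baxt_class 3 w) = phi3 s w)
          \<and> \<Phi> \<in> involution_monoid_hom (baxt 3) (sharp 3) (UT 15) (skew_transpose 15)
          \<and> inj_on \<Phi> (carrier (baxt 3)))"
proof (intro conjI involution_monoid_baxt involution_monoid_UT)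
  \<comment> \<open>An arbitrary representative is chosen; \<open>phi3_eq_iff\<close> makes the
    value independent of it.\<close>
  define \<Phi> where "\<Phi> X = phi3 s (SOME w. w \<in> X)" for X
  have \<Phi>: "\<Phi> (baxt_class 3 w) = phi3 s w" if "w \<in> words 3" for w
  proof -
    have "w \<in> baxt_class 3 w" using that by (simp add: mem_baxt_class baxt_rel_refl)
    then have rel: "(w, SOME v. v \<in> baxt_class 3 w) \<in> baxt_rel 3"
      unfolding mem_baxt_class[symmetric] by (rule someI)
    then show ?thesis
      unfolding \<Phi>_def using phi3_eq_iff[OF infinite_order] baxt_rel_sound by metis
  qed
  have "\<Phi> \<in> hom (baxt 3) (UT 15)"
  proof (rule homI)
    fix x y assume "x \<in> carrier (baxt 3)" "y \<in> carrier (baxt 3)"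
    then obtain u v where "u \<in> words 3" "x = baxt_class 3 u" "v \<in> words 3" "y = baxt_class 3 v"
      unfolding carrier_baxt by blast
    then show "\<Phi> (x \<otimes>\<^bsub>baxt 3\<^esub> y) = \<Phi> x \<otimes>\<^bsub>UT 15\<^esub> \<Phi> y"
      by (simp add: baxt_mult_class \<Phi> phi3_append UT_simps del: One_nat_def)
  next
    fix x assume "x \<in> carrier (baxt 3)"
    then obtain u where "u \<in> words 3" "x = baxt_class 3 u" unfolding carrier_baxt by blast
    then show "\<Phi> x \<in> carrier (UT 15)" using \<Phi> phi3_closed by metis
  qed
  moreover have "\<Phi> \<one>\<^bsub>baxt 3\<^esub> = \<one>\<^bsub>UT 15\<^esub>"
    using \<Phi>[of "[]"] by (simp add: baxt_def phi3_Nil UT_simps)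
  moreover have "\<Phi> (sharp 3 x) = skew_transpose 15 (\<Phi> x)" if x: "x \<in> carrier (baxt 3)" for x
  proof -
    obtain u where "u \<in> words 3" "x = baxt_class 3 u" using x unfolding carrier_baxt by blast
    then show ?thesis
      by (simp add: sharp_baxt_class sharp_word_closed \<Phi> phi3_sharp_word del: One_nat_def)
  qed
  ultimately have "\<Phi> \<in> involution_monoid_hom (baxt 3) (sharp 3) (UT 15) (skew_transpose 15)"
    by (simp add: involution_monoid_hom_def)
  moreover have "inj_on \<Phi> (carrier (baxt 3))"
  proof (rule inj_onI)
    fix x y assume "x \<in> carrier (baxt 3)" "y \<in> carrier (baxt 3)" and eq: "\<Phi> x = \<Phi> y"
    then obtain u v where uv: "u \<in> words 3" "x = baxt_class 3 u" "v \<in> words 3" "y = baxt_class 3 v"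
      unfolding carrier_baxt by blast
    then have "(u, v) \<in> baxt_rel 3"
      using eq \<Phi> phi3_eq_iff[OF infinite_order uv(1,3)] by simp
    then show "x = y" using baxt_class_eq_iff uv by simp
  qed
  ultimately show "\<exists>\<Phi>. (\<forall>w\<in>words 3. \<Phi> (baxt_class 3 w) = phi3 s w)
          \<and> \<Phi> \<in> involution_monoid_hom (baxt 3) (sharp 3) (UT 15) (skew_transpose 15)
          \<and> inj_on \<Phi> (carrier (baxt 3))"
    using \<Phi> by blast
qed

end
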